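(* Let $I_1,I_2$ be intervals of $\mathbb{R}$, $t_0\in I_1$, $s_0\in I_2$, and let $\alpha=\alpha(t)\subset\mathbb{C}\setminus\{0\}$, $t\in I_1$, and $\omega=\omega(s)\subset\mathbb{C}\setminus\{0\}$, $s\in I_2$, be regular planar curves. Let $\Phi=\alpha\ast\omega:I_1\times I_2\to\mathbb{C}^2=\mathbb{C}\times\mathbb{C}$ be the Lagrangian immersion $$\Phi(t,s)=\left(\int_{s_0}^s\dot\omega(y)\overline{\omega(y)}\,dy-\int_{t_0}^t\alpha'(x)\overline{\alpha(x)}\,dx\, ,\ \alpha(t)\omega(s)\right).$$ Then $\Phi$ is a (non totally geodesic) self-similar solution for mean curvature flow if and only if $\alpha$ and $\omega$ are both circles of radius one centered at the origin, so that $\Phi=\alpha\ast\omega$ describes the right circular cylinder $\mathbb{R}\times\mathbb{S}^1$.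
   Context: Here $'$ and $\dot{}$ denote derivatives with respect to $t$ and $s$ respectively. Lagrangian means that the Kaehler two-form $-\mathrm{Im}(z_1\bar w_1+z_2\bar w_2)$ of $\mathbb{C}^2$ pulls back to zero; the immersion $\Phi$ above is always Lagrangian, with induced metric $(|\alpha|^2+|\omega|^2)(|\alpha'|^2dt^2+|\dot\omega|^2ds^2)$. An immersion $\phi:M\to\mathbb{R}^4\equiv\mathbb{C}^2$ of a surface is called a self-similar solution for mean curvature flow if $H=\pm\phi^\perp$, where $\phi^\perp$ denotes the normal projection of the position vector $\phi$ and $H=\mathrm{trace}\,\sigma$ is the mean curvature vector, $\sigma$ being the second fundamental form (no factor $1/2$). It is called a self-shrinker if $H=-\phi^\perp$ and a self-expander if $H=\phi^\perp$. Totally geodesic means $\sigma\equiv 0$. $\mathbb{S}^1$ is the unit circle.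
   Formalization: "Circles of radius one" becomes centred circles of radii r and 1/r for some r>0, since α=2e^{it}, ω=e^{is}/2 also gives the cylinder and refutes the literal "only if"; radius one for both is proved when |α(t0)|=|ω(s0)|. *)

theory Defs
  imports "HOL-Analysis.Analysis"
begin

section \<open>Curves on intervals\<close>

text \<open>
  Derivatives are taken within the domain, so that they are one-sided at an end point belonging to
  the interval. Two derivatives are what the second fundamental form of
  a product \<open>\<alpha> \<star> \<omega>\<close> needs.
\<close>

definition nondegenerate_interval :: "real set \<Rightarrow> bool" where
  "nondegenerate_interval I \<longleftrightarrow> is_interval I \<and> interior I \<noteq> {}"

definition curve_deriv :: "real set \<Rightarrow> (real \<Rightarrow> complex) \<Rightarrow> real \<Rightarrow> complex" where
  "curve_deriv I \<gamma> t = vector_derivative \<gamma> (at t within I)"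

definition regular_curve :: "real set \<Rightarrow> (real \<Rightarrow> complex) \<Rightarrow> bool" where
  "regular_curve I \<gamma> \<longleftrightarrow>
     \<gamma> differentiable_on I \<and> curve_deriv I \<gamma> differentiable_on I \<and>
     continuous_on I (curve_deriv I (curve_deriv I \<gamma>)) \<and>
     (\<forall>t\<in>I. curve_deriv I \<gamma> t \<noteq> 0)"


section \<open>Surfaces in complex two-space\<close>

text \<open>
  The type \<^typ>\<open>complex \<times> complex\<close> carries the inner product
  \<open>Re (z1 * cnj w1 + z2 * cnj w2)\<close>, i.e. it is Euclidean four-space.
\<close>

type_synonym surface = "real \<times> real \<Rightarrow> complex \<times> complex"

definition partial1 :: "real set \<Rightarrow> surface \<Rightarrow> surface" where
  "partial1 I F = (\<lambda>(t, s). vector_derivative (\<lambda>x. F (x, s)) (at t within I))"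

definition partial2 :: "real set \<Rightarrow> surface \<Rightarrow> surface" where
  "partial2 J F = (\<lambda>(t, s). vector_derivative (\<lambda>y. F (t, y)) (at s within J))"

definition immersion_on :: "real set \<Rightarrow> real set \<Rightarrow> surface \<Rightarrow> bool" where
  "immersion_on I J F \<longleftrightarrow>
     (\<forall>p \<in> I \<times> J. F differentiable (at p within I \<times> J) \<and>
        inj (\<lambda>(a::real, b::real). a *\<^sub>R partial1 I F p + b *\<^sub>R partial2 J F p))"

definition kaehler_form :: "complex \<times> complex \<Rightarrow> complex \<times> complex \<Rightarrow> real" where
  "kaehler_form z w = - Im (fst z * cnj (fst w) + snd z * cnj (snd w))"

definition lagrangian_on :: "real set \<Rightarrow> real set \<Rightarrow> surface \<Rightarrow> bool" where
  "lagrangian_on I J F \<longleftrightarrow> (\<forall>p \<in> I \<times> J. kaehler_form (partial1 I F p) (partial2 J F p) = 0)"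

definition tangent_plane ::
    "real set \<Rightarrow> real set \<Rightarrow> surface \<Rightarrow> real \<times> real \<Rightarrow> (complex \<times> complex) set" where
  "tangent_plane I J F p = span {partial1 I F p, partial2 J F p}"

definition normal_part ::
    "real set \<Rightarrow> real set \<Rightarrow> surface \<Rightarrow> real \<times> real \<Rightarrow> complex \<times> complex \<Rightarrow> complex \<times> complex" where
  "normal_part I J F p v =
     (THE n. n \<in> (tangent_plane I J F p)\<^sup>\<bottom> \<and> v - n \<in> tangent_plane I J F p)"

text \<open>
  The components of the second fundamental form in the coordinate frame: the ambient connection is
  flat, so they are the normal parts of the second partial derivatives.
\<close>

definition sigma11 :: "real set \<Rightarrow> real set \<Rightarrow> surface \<Rightarrow> surface" where
  "sigma11 I J F p = normal_part I J F p (partial1 I (partial1 I F) p)"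

definition sigma12 :: "real set \<Rightarrow> real set \<Rightarrow> surface \<Rightarrow> surface" where
  "sigma12 I J F p = normal_part I J F p (partial2 J (partial1 I F) p)"

definition sigma22 :: "real set \<Rightarrow> real set \<Rightarrow> surface \<Rightarrow> surface" where
  "sigma22 I J F p = normal_part I J F p (partial2 J (partial2 J F) p)"

definition totally_geodesic :: "real set \<Rightarrow> real set \<Rightarrow> surface \<Rightarrow> bool" where
  "totally_geodesic I J F \<longleftrightarrow>
     (\<forall>p \<in> I \<times> J. sigma11 I J F p = 0 \<and> sigma12 I J F p = 0 \<and> sigma22 I J F p = 0)"

text \<open>
  The trace of the second fundamental form with respect to the induced metric, i.e. the contraction
  with the inverse of the matrix \<open>((E, G), (G, K))\<close> of the first fundamental form. There is no
  factor one half.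
\<close>

definition mean_curvature :: "real set \<Rightarrow> real set \<Rightarrow> surface \<Rightarrow> surface" where
  "mean_curvature I J F p =
     (let E = partial1 I F p \<bullet> partial1 I F p;
          G = partial1 I F p \<bullet> partial2 J F p;
          K = partial2 J F p \<bullet> partial2 J F p
      in (1 / (E * K - G\<^sup>2)) *\<^sub>R
           (K *\<^sub>R sigma11 I J F p - (2 * G) *\<^sub>R sigma12 I J F p + E *\<^sub>R sigma22 I J F p))"

definition self_shrinker :: "real set \<Rightarrow> real set \<Rightarrow> surface \<Rightarrow> bool" where
  "self_shrinker I J F \<longleftrightarrow> immersion_on I J F \<and>
     (\<forall>p \<in> I \<times> J. mean_curvature I J F p = - normal_part I J F p (F p))"

definition self_expander :: "real set \<Rightarrow> real set \<Rightarrow> surface \<Rightarrow> bool" where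
  "self_expander I J F \<longleftrightarrow> immersion_on I J F \<and>
     (\<forall>p \<in> I \<times> J. mean_curvature I J F p = normal_part I J F p (F p))"

definition self_similar_solution :: "real set \<Rightarrow> real set \<Rightarrow> surface \<Rightarrow> bool" where
  "self_similar_solution I J F \<longleftrightarrow> self_shrinker I J F \<or> self_expander I J F"


section \<open>The immersion built from two planar curves\<close>

definition curve_star ::
    "real set \<Rightarrow> real set \<Rightarrow> real \<Rightarrow> real \<Rightarrow> (real \<Rightarrow> complex) \<Rightarrow> (real \<Rightarrow> complex) \<Rightarrow> surface" where
  "curve_star I J t0 s0 \<alpha> \<omega> = (\<lambda>(t, s).
     ((LBINT y=s0..s. curve_deriv J \<omega> y * cnj (\<omega> y)) - (LBINT x=t0..t. curve_deriv I \<alpha> x * cnj (\<alpha> x)),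
      \<alpha> t * \<omega> s))"

text \<open>
  A regular curve satisfying this parametrizes an arc of the circle. Circles of radii \<open>r\<close> and \<open>1 / r\<close>
  have to be admitted together: \<open>r * cis t\<close> and \<open>cis s / r\<close> give the surface
  \<open>(\<i> * (s / r\<^sup>2 - r\<^sup>2 * t), cis (t + s))\<close>, which is the same right circular cylinder, of radius one,
  for every \<open>r > 0\<close>, and hence a self-shrinker. Equal radii then means radius one.
\<close>

definition on_centred_circle :: "real set \<Rightarrow> (real \<Rightarrow> complex) \<Rightarrow> real \<Rightarrow> bool" where
  "on_centred_circle I \<gamma> r \<longleftrightarrow> \<gamma> ` I \<subseteq> sphere 0 r"

text \<open>\<open>\<real> \<times> S\<^sup>1\<close>, with axis the imaginary line of the first complex coordinate.\<close>

definition right_circular_cylinder :: "(complex \<times> complex) set" where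
  "right_circular_cylinder = {z. Re z = 0} \<times> sphere 0 1"

end

theory Submission
  imports Defs
begin

text \<open>
  Write \<open>A\<close> and \<open>\<Omega>\<close> for the integrals of \<open>\<alpha>' cnj \<alpha>\<close> and \<open>\<omega>' cnj \<omega>\<close>. The frame
  \<open>\<Phi>\<^sub>t = \<alpha>' (- cnj \<alpha>, \<omega>)\<close>, \<open>\<Phi>\<^sub>s = \<omega>' (cnj \<omega>, \<alpha>)\<close> is Hermitian orthogonal, and in it
  \<open>H = e \<Phi>\<^sup>\<bottom>\<close> becomes
  \<open>Im (\<alpha>'' / \<alpha>') / |\<alpha>'|\<^sup>2 = e Im (\<alpha> / \<alpha>' (|\<omega>|\<^sup>2 - \<Omega> + A))\<close> together with the equation
  obtained by exchanging the two curves. Differentiating in \<open>s\<close> shows that \<open>p(t) q(s)\<close> is real for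
  all \<open>t, s\<close>, where \<open>p = \<alpha> cnj \<alpha>'\<close> and \<open>q = \<omega> cnj \<omega>'\<close>, so that both curves are logarithmic
  spirals. If \<open>p\<close> and \<open>q\<close> are real, the curves are straight and the surface is totally geodesic.
  Otherwise the equations collapse to \<open>1 / |\<alpha>(t)|\<^sup>2 + e |\<omega>(s\<^sub>0)|\<^sup>2 = 0\<close> and
  \<open>1 / |\<omega>(s)|\<^sup>2 + e |\<alpha>(t\<^sub>0)|\<^sup>2 = 0\<close>, which force \<open>e = -1\<close> and circles of reciprocal radii.
  For such circles \<open>\<alpha> = \<alpha>(t\<^sub>0) exp (A / r\<^sup>2)\<close> and \<open>\<omega> = \<omega>(s\<^sub>0) exp (r\<^sup>2 \<Omega>)\<close> with \<open>A\<close> and \<open>\<Omega>\<close>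
  imaginary and strictly monotone, so that \<open>\<Phi>\<close> is an invertible linear map in \<open>(A, \<Omega>)\<close> followed by
  the universal covering of the cylinder.
\<close>

section \<open>Calculus on intervals\<close>

text \<open>The fundamental theorem is applied on a compact \<open>{a..b}\<close> inside
  \<open>I\<close> that contains \<open>c\<close> and agrees with \<open>I\<close> near
  \<open>t\<close>, so that both sets give the same derivative at \<open>t\<close>.\<close>

lemma has_vector_derivative_integral_interval:
  fixes f :: "real \<Rightarrow> 'a::euclidean_space"
  assumes I: "is_interval I" and f: "continuous_on I f" and c: "c \<in> I" and t: "t \<in> I"
  shows "((\<lambda>u. LBINT y=c..u. f y) has_vector_derivative f t) (at t within I)"
proof -
  have mem: "x \<in> I" if "a \<in> I" "b \<in> I" "a \<le> x" "x \<le> b" for a b x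
    using I that unfolding is_interval_1 by blast
  \<comment> \<open>\<open>a\<close> lies strictly to the left of \<open>t\<close> unless
    \<open>t\<close> is the left end point of \<open>I\<close>; \<open>b\<close> is chosen
    symmetrically.\<close>
  obtain a where a: "a \<in> I" "a \<le> min c t" "a < t \<or> (\<forall>x\<in>I. t \<le> x)"
  proof (cases "\<forall>x\<in>I. t \<le> x")
    case True then show ?thesis using that[of t] c t by auto
  next
    case False
    then obtain x where "x \<in> I" "x < t" by force
    then show ?thesis using that[of "min c x"] c by (auto simp: min_def)
  qed
  obtain b where b: "b \<in> I" "max c t \<le> b" "t < b \<or> (\<forall>x\<in>I. x \<le> t)"
  proof (cases "\<forall>x\<in>I. x \<le> t")
    case True then show ?thesis using that[of t] c t by auto
  next
    case False
    then obtain x where "x \<in> I" "t < x" by force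
    then show ?thesis using that[of "max c x"] c by (auto simp: max_def)
  qed
  have ab: "{a..b} \<subseteq> I" using mem[OF a(1) b(1)] by (simp add: subset_iff)
  \<comment> \<open>On a side where \<open>I\<close> ends at \<open>t\<close>, any margin serves for
    the neighbourhood; hence the default distance 1.\<close>
  define l where "l = (if a < t then a else t - 1)"
  define u where "u = (if t < b then b else t + 1)"
  have "a \<le> x" if "x \<in> I" "l < x" for x
    using a that by (cases "a < t") (auto simp: l_def)
  moreover have "x \<le> b" if "x \<in> I" "x < u" for x
    using b that by (cases "t < b") (auto simp: u_def)
  ultimately have "{a..b} \<inter> {l<..<u} = I \<inter> {l<..<u}"
    using ab by auto
  then have "at t within {a..b} = at t within I"
    by (intro at_within_nhd[of t "{l<..<u}"]) (auto simp: l_def u_def)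
  moreover have "((\<lambda>u. LBINT y=c..u. f y) has_vector_derivative f t) (at t within {a..b})"
    by (rule interval_integral_FTC2) (use a b ab f continuous_on_subset in auto)
  ultimately show ?thesis by simp
qed

text \<open>A connected set with more than one point has no isolated point. This makes derivatives
  within \<open>I\<close> unique, also at end points.\<close>

lemma at_within_nondegenerate_interval:
  assumes I: "nondegenerate_interval I" and t: "t \<in> I"
  shows "at t within I \<noteq> bot"
proof -
  have "I \<noteq> {x}" for x
    using I interior_singleton[of x] unfolding nondegenerate_interval_def by metis
  then have "t islimpt I"
    using I t connected_imp_perfect is_interval_connected_1
    unfolding nondegenerate_interval_def by blast
  then show ?thesis by (simp add: trivial_limit_within)
qed

lemma vector_derivative_interval:
  assumes "nondegenerate_interval I" "t \<in> I" "(f has_vector_derivative f') (at t within I)"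
  shows "vector_derivative f (at t within I) = f'"
  using assms at_within_nondegenerate_interval vector_derivative_within by blast

lemma has_vector_derivative_zero_eq:
  fixes f :: "real \<Rightarrow> 'a::real_normed_vector"
  assumes "is_interval I" "a \<in> I" "b \<in> I"
    and "\<And>x. x \<in> I \<Longrightarrow> (f has_vector_derivative 0) (at x within I)"
  shows "f a = f b"
  using has_vector_derivative_zero_constant[of I f] assms is_interval_convex by metis

lemma has_vector_derivative_Im_mult:
  fixes f :: "real \<Rightarrow> complex"
  assumes "(f has_vector_derivative f') F"
  shows "((\<lambda>x. Im (w * f x)) has_vector_derivative Im (w * f')) F"
  by (rule bounded_linear.has_vector_derivative[OF bounded_linear_compose[OF bounded_linear_Im
          bounded_linear_mult_right] assms])

section \<open>Planar curves\<close>

locale plane_curve =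
  fixes I :: "real set" and t0 :: real and \<gamma> :: "real \<Rightarrow> complex"
  assumes nondegenerate: "nondegenerate_interval I"
    and t0: "t0 \<in> I"
    and regular: "regular_curve I \<gamma>"
    and nonzero: "t \<in> I \<Longrightarrow> \<gamma> t \<noteq> 0"
begin

abbreviation "d1 \<equiv> curve_deriv I \<gamma>"
abbreviation "d2 \<equiv> curve_deriv I d1"

text \<open>The real part is half the increase of \<open>|\<gamma>|^2\<close> from \<open>t0\<close>
  to \<open>t\<close>; the imaginary part is twice the signed area swept by the radius
  vector.\<close>

definition area :: "real \<Rightarrow> complex" where
  "area t = (LBINT x=t0..t. d1 x * cnj (\<gamma> x))"

lemma interval: "is_interval I"
  using nondegenerate unfolding nondegenerate_interval_def by blast

lemma deriv_eqI: "t \<in> I \<Longrightarrow> (f has_vector_derivative f') (at t within I) \<Longrightarrow>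
    vector_derivative f (at t within I) = f'"
  using vector_derivative_interval[OF nondegenerate] .

lemma deriv_unique: "t \<in> I \<Longrightarrow> (f has_vector_derivative f') (at t within I) \<Longrightarrow>
    (f has_vector_derivative f'') (at t within I) \<Longrightarrow> f' = f''"
  using deriv_eqI by metis

lemma deriv_const_on:
  assumes "t \<in> I" "(f has_vector_derivative f') (at t within I)" "\<And>x. x \<in> I \<Longrightarrow> f x = c"
  shows "f' = 0"
proof -
  have "(f has_vector_derivative 0) (at t within I)"
    by (rule has_vector_derivative_transform[of _ _ _ "\<lambda>_. c"]) (use assms in auto)
  then show ?thesis using deriv_unique assms(1,2) by blast
qed

lemma d1_nonzero: "t \<in> I \<Longrightarrow> d1 t \<noteq> 0"
  using regular unfolding regular_curve_def by blast

lemma has_d1 [derivative_intros]: "t \<in> I \<Longrightarrow> (\<gamma> has_vector_derivative d1 t) (at t within I)"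
  using regular vector_derivative_works
  unfolding regular_curve_def differentiable_on_def curve_deriv_def by blast

lemma has_d2 [derivative_intros]: "t \<in> I \<Longrightarrow> (d1 has_vector_derivative d2 t) (at t within I)"
  using regular vector_derivative_works
  unfolding regular_curve_def differentiable_on_def curve_deriv_def by blast

lemma continuous_curve: "continuous_on I \<gamma>" and continuous_d1: "continuous_on I d1"
  using regular differentiable_imp_continuous_on unfolding regular_curve_def by blast+

lemma has_area [derivative_intros]:
  "t \<in> I \<Longrightarrow> (area has_vector_derivative d1 t * cnj (\<gamma> t)) (at t within I)"
  unfolding area_def
  by (rule has_vector_derivative_integral_interval)
    (use interval t0 in \<open>auto intro!: continuous_intros continuous_curve continuous_d1\<close>)

lemma area_t0 [simp]: "area t0 = 0"
  unfolding area_def by simp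

text \<open>This combination enters the normal part of the position vector. One of the two product
  rule terms cancels against the derivative of \<open>area\<close>.\<close>

lemma has_norm2_minus_area:
  "t \<in> I \<Longrightarrow> ((\<lambda>t. \<gamma> t * cnj (\<gamma> t) - area t) has_vector_derivative \<gamma> t * cnj (d1 t)) (at t within I)"
  by (rule has_vector_derivative_eq_rhs, (rule derivative_intros; assumption?)+) simp

text \<open>The hypothesis says that \<open>\<gamma>\<close> is a logarithmic spiral, degenerating to a line for real \<open>w\<close> and to a
  circle for imaginary \<open>w\<close>.\<close>

lemma spiral_curvature:
  assumes p: "\<And>t. t \<in> I \<Longrightarrow> Im (\<gamma> t * cnj (d1 t) * w) = 0" and "w \<noteq> 0" and t: "t \<in> I"
  shows "Im (d2 t / d1 t) = - Im (\<gamma> t * cnj (d1 t)) / (norm (\<gamma> t))\<^sup>2"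
proof -
  let ?q = "\<gamma> t * cnj (d2 t) + d1 t * cnj (d1 t)"
  let ?p = "\<gamma> t * cnj (d1 t)"
  have "((\<lambda>t. \<gamma> t * cnj (d1 t)) has_vector_derivative ?q) (at t within I)"
    using t by (auto intro!: derivative_eq_intros)
  then have "((\<lambda>t. Im (w * (\<gamma> t * cnj (d1 t)))) has_vector_derivative Im (w * ?q)) (at t within I)"
    by (rule has_vector_derivative_Im_mult)
  then have "Im (w * ?q) = 0"
    using p deriv_const_on[OF t] by (auto simp: ac_simps)
  moreover have "Im (w * ?p) = 0" using p[OF t] by (simp add: ac_simps)
  ultimately have "Im ((w * ?q) / (w * ?p)) = 0"
    by (metis Reals_divide complex_is_Real_iff)
  moreover have "(w * ?q) / (w * ?p) = cnj (d2 t / d1 t) + d1 t / \<gamma> t"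
    using \<open>w \<noteq> 0\<close> nonzero[OF t] d1_nonzero[OF t] by (simp add: field_simps)
  moreover have "d1 t / \<gamma> t = cnj ?p / of_real ((norm (\<gamma> t))\<^sup>2)"
    using nonzero[OF t] by (simp only: complex_norm_square) (simp add: field_simps)
  ultimately show ?thesis by (simp only: plus_complex.sel cnj.sel Im_divide_of_real)
qed

text \<open>The derivative of \<open>cnj w * area t\<close> is the conjugate of
  \<open>\<gamma> t * cnj (d1 t) * w\<close>, hence real, and \<open>area\<close> starts at
  0.\<close>

lemma spiral_area:
  assumes p: "\<And>t. t \<in> I \<Longrightarrow> Im (\<gamma> t * cnj (d1 t) * w) = 0" and t: "t \<in> I"
  shows "Im (cnj w * area t) = 0"
proof -
  have "((\<lambda>t. Im (cnj w * area t)) has_vector_derivative 0) (at t within I)" if "t \<in> I" for t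
  proof (rule has_vector_derivative_eq_rhs)
    show "((\<lambda>t. Im (cnj w * area t)) has_vector_derivative Im (cnj w * (d1 t * cnj (\<gamma> t)))) (at t within I)"
      using that by (intro has_vector_derivative_Im_mult has_area)
    show "Im (cnj w * (d1 t * cnj (\<gamma> t))) = 0"
      using p[OF that] by (simp add: algebra_simps)
  qed
  from has_vector_derivative_zero_eq[OF interval t t0 this] show ?thesis by simp
qed

text \<open>The \<open>area\<close> term drops out: \<open>?p * w\<close> and
  \<open>cnj w * area t\<close> are real, and \<open>w * cnj w\<close> is a positive real, so
  \<open>?p * area t\<close> is real. Both sides are then real multiples of \<open>Im ?p\<close>. In
  \<open>self_similar_imp_circles\<close>, \<open>k\<close> is the squared modulus of the other
  curve at its base point.\<close>

lemma spiral_equation: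
  assumes p: "\<And>t. t \<in> I \<Longrightarrow> Im (\<gamma> t * cnj (d1 t) * w) = 0" and "w \<noteq> 0" and t: "t \<in> I"
  shows "Im (d2 t / d1 t) / (norm (d1 t))\<^sup>2 = e * Im (\<gamma> t / d1 t * (of_real k + area t)) \<longleftrightarrow>
         Im (\<gamma> t * cnj (d1 t)) * (1 / (norm (\<gamma> t))\<^sup>2 + e * k) = 0"
proof -
  let ?p = "\<gamma> t * cnj (d1 t)" and ?n = "(norm (d1 t))\<^sup>2" and ?m = "(norm (\<gamma> t))\<^sup>2"
  have n: "?n \<noteq> 0" using d1_nonzero[OF t] by simp
  have "Im ((?p * w) * (cnj w * area t)) = 0"
    using p[OF t] spiral_area[OF p t] by simp
  moreover have "(?p * w) * (cnj w * area t) = of_real ((norm w)\<^sup>2) * (?p * area t)"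
    by (simp only: complex_norm_square) (simp add: ac_simps)
  ultimately have pa: "Im (?p * area t) = 0"
    using \<open>w \<noteq> 0\<close> times_complex.sel(2)[of "of_real ((norm w)\<^sup>2)" "?p * area t"] by simp
  have "\<gamma> t / d1 t * (of_real k + area t) = (k *\<^sub>R ?p + ?p * area t) / of_real ?n"
    using d1_nonzero[OF t]
    by (simp only: complex_norm_square scaleR_conv_of_real) (simp add: field_simps)
  then have 1: "Im (\<gamma> t / d1 t * (of_real k + area t)) = k * Im ?p / ?n"
    using pa by (simp only: Im_divide_of_real plus_complex.sel scaleR_complex.sel) simp
  have 2: "Im (d2 t / d1 t) = - Im ?p / ?m"
    by (rule spiral_curvature[OF _ \<open>w \<noteq> 0\<close> t]) (rule p)
  have iff: "- x / y / z = e * (k * x / z) \<longleftrightarrow> x * (1 / y + e * k) = 0" if "z \<noteq> 0" for x y z :: real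
  proof -
    have "- x / y / z = e * (k * x / z) \<longleftrightarrow> - x / y = e * k * x"
      using that by (metis div_by_0 divide_cancel_right mult.assoc times_divide_eq_right)
    also have "\<dots> \<longleftrightarrow> x * (1 / y + e * k) = 0"
      by (auto simp: algebra_simps)
    finally show ?thesis .
  qed
  show ?thesis unfolding 1 2 by (rule iff[OF n])
qed

section \<open>Curves on a centred circle\<close>

lemma circle_spiral:
  assumes r: "\<And>t. t \<in> I \<Longrightarrow> norm (\<gamma> t) = r" and t: "t \<in> I"
  shows "Re (\<gamma> t * cnj (d1 t)) = 0"
proof -
  have "((\<lambda>t. \<gamma> t * cnj (\<gamma> t)) has_vector_derivative \<gamma> t * cnj (d1 t) + d1 t * cnj (\<gamma> t)) (at t within I)"
    using t by (auto intro!: derivative_eq_intros)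
  moreover have "\<gamma> t * cnj (\<gamma> t) = of_real (r\<^sup>2)" if "t \<in> I" for t
    using complex_norm_square[of "\<gamma> t"] unfolding r[OF that] by (rule sym)
  ultimately have "\<gamma> t * cnj (d1 t) + d1 t * cnj (\<gamma> t) = 0"
    using deriv_const_on[OF t] by blast
  then have "Re (\<gamma> t * cnj (d1 t) + d1 t * cnj (\<gamma> t)) = 0" by (simp only: zero_complex.sel)
  then show ?thesis by simp
qed

text \<open>A circle is the case \<open>w = \<i>\<close> of the spirals above,
  \<open>circle_spiral\<close> being the hypothesis.\<close>

lemma circle_area:
  assumes r: "\<And>t. t \<in> I \<Longrightarrow> norm (\<gamma> t) = r" and t: "t \<in> I"
  shows "Re (area t) = 0"
  using spiral_area[of \<i> t] circle_spiral[OF r] t by simp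

text \<open>From \<open>\<gamma> * cnj \<gamma> = r^2\<close> follows the linear equation
  \<open>\<gamma>' = (area' / r^2) * \<gamma>\<close>. The proof checks that \<open>\<gamma>\<close>
  times the inverse exponential is constant.\<close>

lemma circle_lift:
  assumes r: "\<And>t. t \<in> I \<Longrightarrow> norm (\<gamma> t) = r" and t: "t \<in> I"
  shows "\<gamma> t = \<gamma> t0 * exp (area t / of_real (r\<^sup>2))"
proof -
  let ?R = "complex_of_real (r\<^sup>2)"
  have R: "?R \<noteq> 0" using r[OF t0] nonzero[OF t0] by auto
  have "((\<lambda>t. \<gamma> t * exp (- area t / ?R)) has_vector_derivative 0) (at t within I)" if "t \<in> I" for t
  proof (rule has_vector_derivative_eq_rhs)
    have "((\<lambda>t. exp (- area t / ?R)) has_vector_derivative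
        (- (d1 t * cnj (\<gamma> t)) / ?R) * exp (- area t / ?R)) (at t within I)"
      using that by (intro field_vector_diff_chain_within[where g = exp, unfolded o_def])
        (auto intro!: derivative_eq_intros)
    then show "((\<lambda>t. \<gamma> t * exp (- area t / ?R)) has_vector_derivative
        \<gamma> t * ((- (d1 t * cnj (\<gamma> t)) / ?R) * exp (- area t / ?R)) + d1 t * exp (- area t / ?R))
        (at t within I)"
      using that by (intro derivative_intros)
    have "?R = \<gamma> t * cnj (\<gamma> t)"
      using complex_norm_square[of "\<gamma> t"] unfolding r[OF that] .
    then have "\<gamma> t * (- (d1 t * cnj (\<gamma> t)) / ?R) = - d1 t"
      using nonzero[OF that] by (simp add: field_simps)
    then show "\<gamma> t * ((- (d1 t * cnj (\<gamma> t)) / ?R) * exp (- area t / ?R)) + d1 t * exp (- area t / ?R) = 0"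
      by (metis add.commute add_minus_cancel add_0_right mult.assoc mult_minus_left)
  qed
  from has_vector_derivative_zero_eq[OF interval t t0 this]
  have "\<gamma> t * exp (- area t / ?R) = \<gamma> t0" by simp
  then show ?thesis by (auto simp: exp_minus field_simps)
qed

text \<open>On a circle the derivative of \<open>area\<close> is imaginary with modulus
  \<open>norm (d1 t) * r\<close>, and the mean value theorem applies. End points in the interior
  make the derivatives two-sided.\<close>

lemma circle_increment:
  assumes r: "\<And>t. t \<in> I \<Longrightarrow> norm (\<gamma> t) = r" and x: "x \<in> interior I" and y: "y \<in> interior I"
    and "x < y"
  obtains z where "z \<in> I" "\<bar>Im (area y) - Im (area x)\<bar> = (y - x) * (norm (d1 z) * r)"
proof -
  have sub: "{x..y} \<subseteq> interior I"
  proof -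
    have "is_interval (interior I)"
      using interval convex_interior is_interval_convex_1 by metis
    then show ?thesis using x y unfolding is_interval_1 by (meson atLeastAtMost_iff subsetI)
  qed
  have "((\<lambda>t. Im (area t)) has_real_derivative Im (d1 t * cnj (\<gamma> t))) (at t)" if "x \<le> t" "t \<le> y" for t
  proof -
    have t: "t \<in> interior I" using that sub by auto
    then have "(area has_vector_derivative d1 t * cnj (\<gamma> t)) (at t)"
      using has_area[of t] interior_subset at_within_interior[OF t] by auto
    then show ?thesis
      unfolding has_real_derivative_iff_has_vector_derivative
      by (rule bounded_linear.has_vector_derivative[OF bounded_linear_Im])
  qed
  from MVT2[OF \<open>x < y\<close> this] obtain z where z: "x < z" "z < y"
    "Im (area y) - Im (area x) = (y - x) * Im (d1 z * cnj (\<gamma> z))" by blast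
  have zI: "z \<in> I" using z sub interior_subset[of I] by (auto simp: subset_iff)
  have "Re (d1 z * cnj (\<gamma> z)) = 0" using circle_spiral[OF r zI] by (simp add: mult.commute)
  then have "\<bar>Im (d1 z * cnj (\<gamma> z))\<bar> = norm (d1 z * cnj (\<gamma> z))"
    by (simp only: cmod_eq_Im)
  also have "\<dots> = norm (d1 z) * r"
    using r[OF zI] by (simp add: norm_mult)
  finally have "\<bar>Im (area y) - Im (area x)\<bar> = (y - x) * (norm (d1 z) * r)"
    using z(3) \<open>x < y\<close> by (simp add: abs_mult)
  with zI show ?thesis by (rule that)
qed

lemma circle_area_inj:
  assumes r: "\<And>t. t \<in> I \<Longrightarrow> norm (\<gamma> t) = r"
  shows "inj_on (\<lambda>t. Im (area t)) (interior I)"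
proof (rule linorder_inj_onI)
  fix x y assume xy: "x < y" "x \<in> interior I" "y \<in> interior I"
  obtain z where z: "z \<in> I" "\<bar>Im (area y) - Im (area x)\<bar> = (y - x) * (norm (d1 z) * r)"
    using circle_increment[OF r xy(2,3,1)] by blast
  have "r \<noteq> 0" using r[OF t0] nonzero[OF t0] by auto
  then show "Im (area x) \<noteq> Im (area y)" using z d1_nonzero xy(1) by auto
qed auto

text \<open>Invariance of domain in dimension one: a continuous injection of an open set into the
  line has open image.\<close>

lemma circle_area_open:
  assumes r: "\<And>t. t \<in> I \<Longrightarrow> norm (\<gamma> t) = r"
  shows "open ((\<lambda>t. Im (area t)) ` interior I)"
proof (rule injective_into_1d_imp_open_map_UNIV[OF open_interior _ circle_area_inj[OF r] order_refl])
  have "continuous_on I area"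
    using has_area has_vector_derivative_continuous continuous_on_eq_continuous_within by blast
  then show "continuous_on (interior I) (\<lambda>t. Im (area t))"
    by (intro continuous_intros) (use continuous_on_subset interior_subset in blast)
qed

lemma circle_area_surj:
  assumes r: "\<And>t. t \<in> I \<Longrightarrow> norm (\<gamma> t) = r" and I: "I = UNIV" and c: "\<And>t. norm (d1 t) = c"
  shows "surj (\<lambda>t. Im (area t))"
proof -
  define f where "f = (\<lambda>t. Im (area t))"
  have rc: "c * r > 0"
    using r[OF t0] nonzero[OF t0] d1_nonzero[OF t0] c[of t0] by (auto intro!: mult_pos_pos)
  have step: "\<bar>f y - f x\<bar> = (y - x) * (c * r)" if "x < y" for x y
    using circle_increment[OF r, of x y] that c unfolding f_def I by auto
  have "\<exists>t. v = f t" for v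
  proof (cases "v = f 0")
    case False
    \<comment> \<open>\<open>f d\<close> and \<open>f (- d)\<close> both have distance
      \<open>|v - f 0|\<close> from \<open>f 0\<close>. Being twice that distance apart, they lie on
      opposite sides of \<open>f 0\<close>, so one of them is \<open>v\<close>.\<close>
    define d where "d = \<bar>v - f 0\<bar> / (c * r)"
    have "d > 0" "d * (c * r) = \<bar>v - f 0\<bar>" using False rc by (auto simp: d_def)
    with step[of 0 d] step[of "-d" 0] step[of "-d" d]
    have "v = f d \<or> v = f (- d)" by (auto simp: algebra_simps abs_if split: if_splits)
    then show ?thesis by blast
  qed blast
  then show ?thesis unfolding f_def by (auto intro: surjI)
qed

end

section \<open>Hermitian orthogonal frames\<close>

definition cscale :: "complex \<Rightarrow> complex \<times> complex \<Rightarrow> complex \<times> complex" where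
  "cscale c z = (c * fst z, c * snd z)"

lemma fst_cscale [simp]: "fst (cscale c z) = c * fst z"
  and snd_cscale [simp]: "snd (cscale c z) = c * snd z"
  by (simp_all add: cscale_def)

lemma Im_complex_of_real_mult: "Im (of_real r * z) = r * Im z"
  and Im_minus_of_real_mult: "Im (- of_real r * z) = - r * Im z"
  by simp_all

lemma minus_mult_minus_divide: "- a * (- b / c) / d = b * a / (c * d)" for a b c d :: "'a::field"
  by simp

lemma inner_hermitian: "x \<bullet> y = Re (fst x * cnj (fst y) + snd x * cnj (snd y))"
  for x y :: "complex \<times> complex"
  by (simp add: inner_prod_def inner_complex_def)

text \<open>The Hermitian product of the relation with \<open>X\<close>, then with \<open>Y\<close>,
  leaves \<open>a\<close> times \<open>|X|^2\<close> and \<open>b\<close> times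
  \<open>|Y|^2\<close>.\<close>

lemma hermitian_orthogonal_independent:
  fixes X Y :: "complex \<times> complex"
  assumes herm: "fst X * cnj (fst Y) + snd X * cnj (snd Y) = 0" and "X \<noteq> 0" "Y \<noteq> 0"
    and z: "cscale a X + cscale b Y = 0"
  shows "a = 0" "b = 0"
proof -
  have pos: "fst Z * cnj (fst Z) + snd Z * cnj (snd Z) \<noteq> 0" if "Z \<noteq> 0" for Z :: "complex \<times> complex"
  proof -
    have "Z \<bullet> Z \<noteq> 0" using that by simp
    then show ?thesis unfolding inner_hermitian by force
  qed
  have c: "a * fst X + b * fst Y = 0" "a * snd X + b * snd Y = 0"
    using z by (simp_all add: cscale_def zero_prod_def)
  have herm': "fst Y * cnj (fst X) + snd Y * cnj (snd X) = 0"
    using arg_cong[OF herm, of cnj] by (simp add: mult.commute)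
  have "a * (fst X * cnj (fst X) + snd X * cnj (snd X))
      = (a * fst X + b * fst Y) * cnj (fst X) + (a * snd X + b * snd Y) * cnj (snd X)
        - b * (fst Y * cnj (fst X) + snd Y * cnj (snd X))" by algebra
  then show "a = 0" using pos[OF \<open>X \<noteq> 0\<close>] c herm' by simp
  have "b * (fst Y * cnj (fst Y) + snd Y * cnj (snd Y))
      = (a * fst X + b * fst Y) * cnj (fst Y) + (a * snd X + b * snd Y) * cnj (snd Y)
        - a * (fst X * cnj (fst Y) + snd X * cnj (snd Y))" by algebra
  then show "b = 0" using pos[OF \<open>Y \<noteq> 0\<close>] c herm by simp
qed

text \<open>The normal plane of a Lagrangian surface is the tangent plane multiplied by \<open>\<i>\<close>.\<close>

lemma normal_part_lagrangian_frame:
  assumes X: "partial1 I F p = X" and Y: "partial2 J F p = Y"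
    and herm: "fst X * cnj (fst Y) + snd X * cnj (snd Y) = 0"
  shows "normal_part I J F p (cscale a X + cscale b Y) =
           cscale (\<i> * Im a) X + cscale (\<i> * Im b) Y"
proof -
  let ?T = "tangent_plane I J F p" and ?n = "cscale (\<i> * Im a) X + cscale (\<i> * Im b) Y"
  have T: "x \<in> ?T \<longleftrightarrow> (\<exists>c d. x = c *\<^sub>R X + d *\<^sub>R Y)" for x
    unfolding tangent_plane_def X Y span_breakdown_eq span_singleton image_iff
    by (auto simp: diff_eq_eq add.commute)
  have perp: "x \<in> ?T\<^sup>\<bottom> \<longleftrightarrow> (\<forall>y\<in>?T. y \<bullet> x = 0)" for x
    by (auto simp: orthogonal_comp_def orthogonal_def)
  \<comment> \<open>A vector is orthogonal to its multiple by \<open>\<i>\<close>, so only cross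
    terms survive, and they are multiples of the imaginary part of the Hermitian product.\<close>
  have "Y \<bullet> ?n = - Im a * Im (fst X * cnj (fst Y) + snd X * cnj (snd Y))"
    "X \<bullet> ?n = Im b * Im (fst X * cnj (fst Y) + snd X * cnj (snd Y))"
    unfolding inner_hermitian by (simp_all add: algebra_simps)
  then have YX: "X \<bullet> ?n = 0" "Y \<bullet> ?n = 0"
    unfolding herm by simp_all
  have n: "?n \<in> ?T\<^sup>\<bottom>"
    unfolding perp
  proof
    fix y assume "y \<in> ?T"
    then obtain c d where "y = c *\<^sub>R X + d *\<^sub>R Y" unfolding T by blast
    then show "y \<bullet> ?n = 0" by (simp only: inner_left_distrib inner_scaleR_left YX mult_zero_right add_0_right)
  qed
  have "cscale a X + cscale b Y - ?n = Re a *\<^sub>R X + Re b *\<^sub>R Y"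
    by (auto simp: prod_eq_iff complex_eq_iff)
  then have t: "cscale a X + cscale b Y - ?n \<in> ?T" unfolding T by blast
  show ?thesis unfolding normal_part_def
  proof (rule the_equality)
    show "?n \<in> ?T\<^sup>\<bottom> \<and> cscale a X + cscale b Y - ?n \<in> ?T" using n t by blast
    fix m assume m: "m \<in> ?T\<^sup>\<bottom> \<and> cscale a X + cscale b Y - m \<in> ?T"
    \<comment> \<open>Uniqueness: two candidates differ by a vector that is both tangent and
      normal.\<close>
    have "(cscale a X + cscale b Y - ?n) - (cscale a X + cscale b Y - m) \<in> ?T"
      using m t unfolding tangent_plane_def by (blast intro: span_diff)
    then have "m - ?n \<in> ?T" by (simp add: algebra_simps)
    moreover have "m - ?n \<in> ?T\<^sup>\<bottom>"
      using m n by (blast intro: subspace_diff subspace_orthogonal_comp)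
    ultimately have "(m - ?n) \<bullet> (m - ?n) = 0" unfolding perp by blast
    then show "m = ?n" by simp
  qed
qed

section \<open>The geometry of the product of two curves\<close>

locale two_curves = C: plane_curve I t0 \<alpha> + D: plane_curve J s0 \<omega>
  for I t0 \<alpha> J s0 \<omega>
begin

abbreviation "F \<equiv> curve_star I J t0 s0 \<alpha> \<omega>"
abbreviation "X t s \<equiv> cscale (C.d1 t) (- cnj (\<alpha> t), \<omega> s)"
abbreviation "Y t s \<equiv> cscale (D.d1 s) (cnj (\<omega> s), \<alpha> t)"
abbreviation "\<rho> t s \<equiv> (norm (\<alpha> t))\<^sup>2 + (norm (\<omega> s))\<^sup>2"

lemma curve_star_eq: "F (t, s) = (D.area s - C.area t, \<alpha> t * \<omega> s)"
  unfolding curve_star_def C.area_def D.area_def by simp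

lemma partial1_curve_star:
  assumes "t \<in> I" shows "partial1 I F (t, s) = X t s"
  unfolding partial1_def curve_star_eq split_conv
  by (rule C.deriv_eqI[OF assms])
    (auto intro!: derivative_eq_intros assms simp: cscale_def)

lemma partial2_curve_star:
  assumes "s \<in> J" shows "partial2 J F (t, s) = Y t s"
  unfolding partial2_def curve_star_eq split_conv
  by (rule D.deriv_eqI[OF assms])
    (auto intro!: derivative_eq_intros assms simp: cscale_def)

lemma partial11_curve_star:
  assumes "t \<in> I"
  shows "partial1 I (partial1 I F) (t, s) =
    (- (C.d2 t * cnj (\<alpha> t) + C.d1 t * cnj (C.d1 t)), C.d2 t * \<omega> s)"
  unfolding partial1_def[of I "partial1 I F"] split_conv
  by (rule C.deriv_eqI[OF assms], rule has_vector_derivative_transform[OF assms partial1_curve_star],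
      assumption, unfold cscale_def)
    (auto intro!: derivative_eq_intros assms)

lemma partial12_curve_star:
  assumes "t \<in> I" "s \<in> J"
  shows "partial2 J (partial1 I F) (t, s) = (0, C.d1 t * D.d1 s)"
  unfolding partial2_def split_conv partial1_curve_star[OF assms(1)]
  by (rule D.deriv_eqI[OF assms(2)], unfold cscale_def)
    (auto intro!: derivative_eq_intros assms)

lemma partial22_curve_star:
  assumes "s \<in> J"
  shows "partial2 J (partial2 J F) (t, s) =
    (D.d2 s * cnj (\<omega> s) + D.d1 s * cnj (D.d1 s), D.d2 s * \<alpha> t)"
  unfolding partial2_def[of J "partial2 J F"] split_conv
  by (rule D.deriv_eqI[OF assms], rule has_vector_derivative_transform[OF assms partial2_curve_star],
      assumption, unfold cscale_def)
    (auto intro!: derivative_eq_intros assms)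

lemma frame_hermitian: "fst (X t s) * cnj (fst (Y t s)) + snd (X t s) * cnj (snd (Y t s)) = 0"
  by (simp add: algebra_simps)

lemma frame_nonzero: "t \<in> I \<Longrightarrow> s \<in> J \<Longrightarrow> X t s \<noteq> 0" "t \<in> I \<Longrightarrow> s \<in> J \<Longrightarrow> Y t s \<noteq> 0"
  using C.d1_nonzero D.d1_nonzero C.nonzero D.nonzero by (simp_all add: cscale_def zero_prod_def)

lemmas frame_independent = hermitian_orthogonal_independent[OF frame_hermitian frame_nonzero]

lemma normal_part_frame:
  assumes "t \<in> I" "s \<in> J" "v = cscale a (X t s) + cscale b (Y t s)"
  shows "normal_part I J F (t, s) v = cscale (\<i> * Im a) (X t s) + cscale (\<i> * Im b) (Y t s)"
  unfolding assms(3)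
  by (rule normal_part_lagrangian_frame[OF partial1_curve_star partial2_curve_star frame_hermitian])
    (use assms in auto)

lemma rho_nonzero: "t \<in> I \<Longrightarrow> \<rho> t s \<noteq> 0"
  using C.nonzero[of t] by (auto simp: add_nonneg_eq_0_iff)

text \<open>The coefficients are the Hermitian products of \<open>(x, y)\<close> with the frame
  vectors, divided by the squared lengths \<open>|\<alpha>'|^2 * \<rho> t s\<close> and
  \<open>|\<omega>'|^2 * \<rho> t s\<close>.\<close>

lemma frame_expansion:
  assumes "t \<in> I" "s \<in> J"
  shows "(x, y) = cscale ((y * cnj (\<omega> s) - x * \<alpha> t) / (C.d1 t * \<rho> t s)) (X t s)
                + cscale ((x * \<omega> s + y * cnj (\<alpha> t)) / (D.d1 s * \<rho> t s)) (Y t s)"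
proof -
  define r where "r = complex_of_real (\<rho> t s)"
  have r: "r \<noteq> 0" "r = \<alpha> t * cnj (\<alpha> t) + \<omega> s * cnj (\<omega> s)"
    using rho_nonzero[OF assms(1), of s] unfolding r_def of_real_eq_0_iff
    by (simp_all only: of_real_add complex_norm_square not_False_eq_True)
  let ?u = "y * cnj (\<omega> s) - x * \<alpha> t" and ?v = "x * \<omega> s + y * cnj (\<alpha> t)"
  have "x * r = ?v * cnj (\<omega> s) - ?u * cnj (\<alpha> t)" "y * r = ?u * \<omega> s + ?v * \<alpha> t"
    unfolding r(2) by (simp_all add: algebra_simps)
  then have "x = (?v * cnj (\<omega> s) - ?u * cnj (\<alpha> t)) / r" "y = (?u * \<omega> s + ?v * \<alpha> t) / r"
    using r(1) by (simp_all only: eq_divide_eq if_True not_False_eq_True)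
  moreover have "cscale (?u / (C.d1 t * r)) (X t s) + cscale (?v / (D.d1 s * r)) (Y t s) =
      ((?v * cnj (\<omega> s) - ?u * cnj (\<alpha> t)) / r, (?u * \<omega> s + ?v * \<alpha> t) / r)"
    using r(1) C.d1_nonzero[OF assms(1)] D.d1_nonzero[OF assms(2)]
    by (simp add: prod_eq_iff field_simps)
  ultimately show ?thesis unfolding r_def[symmetric] by simp
qed

lemma normal_part_curve_star:
  assumes "t \<in> I" "s \<in> J"
  shows "normal_part I J F (t, s) (x, y) =
    cscale (\<i> * (Im ((y * cnj (\<omega> s) - x * \<alpha> t) / C.d1 t) / \<rho> t s)) (X t s)
    + cscale (\<i> * (Im ((x * \<omega> s + y * cnj (\<alpha> t)) / D.d1 s) / \<rho> t s)) (Y t s)"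
proof -
  have "Im (z / (w * of_real r)) = Im (z / w) / r" for z w r
    using Im_divide_of_real[of "z / w" r] by simp
  then show ?thesis
    by (simp only: normal_part_frame[OF assms frame_expansion[OF assms]])
qed

lemma ratio_eq_cnj:
  "t \<in> I \<Longrightarrow> \<alpha> t / C.d1 t = cnj (C.d1 t * cnj (\<alpha> t)) / of_real ((norm (C.d1 t))\<^sup>2)"
  "s \<in> J \<Longrightarrow> \<omega> s / D.d1 s = cnj (D.d1 s * cnj (\<omega> s)) / of_real ((norm (D.d1 s))\<^sup>2)"
  using C.d1_nonzero D.d1_nonzero
  by (simp_all only: complex_norm_square) (simp_all add: field_simps)

lemma Im_ratio:
  "t \<in> I \<Longrightarrow> Im (\<alpha> t / C.d1 t) = - Im (C.d1 t * cnj (\<alpha> t)) / (norm (C.d1 t))\<^sup>2"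
  "s \<in> J \<Longrightarrow> Im (\<omega> s / D.d1 s) = - Im (D.d1 s * cnj (\<omega> s)) / (norm (D.d1 s))\<^sup>2"
  by (simp_all only: ratio_eq_cnj Im_divide_of_real cnj.sel)

section \<open>Second fundamental form, mean curvature and the scalar equations\<close>

lemma sigma11_curve_star:
  assumes ts: "t \<in> I" "s \<in> J"
  shows "sigma11 I J F (t, s) =
    cscale (\<i> * (Im (C.d2 t / C.d1 t) - Im (C.d1 t * cnj (\<alpha> t)) / \<rho> t s)) (X t s)
    + cscale (\<i> * (Im (D.d1 s * cnj (\<omega> s)) * (norm (C.d1 t))\<^sup>2 / ((norm (D.d1 s))\<^sup>2 * \<rho> t s))) (Y t s)"
proof -
  let ?x = "- (C.d2 t * cnj (\<alpha> t) + C.d1 t * cnj (C.d1 t))" and ?y = "C.d2 t * \<omega> s"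
  have "(?y * cnj (\<omega> s) - ?x * \<alpha> t) / C.d1 t =
      of_real (\<rho> t s) * (C.d2 t / C.d1 t) + cnj (C.d1 t * cnj (\<alpha> t))"
    using C.d1_nonzero[OF ts(1)]
    by (simp only: of_real_add complex_norm_square) (simp add: field_simps)
  then have 1: "Im ((?y * cnj (\<omega> s) - ?x * \<alpha> t) / C.d1 t) / \<rho> t s =
      Im (C.d2 t / C.d1 t) - Im (C.d1 t * cnj (\<alpha> t)) / \<rho> t s"
    using rho_nonzero[OF ts(1), of s] by (simp only: plus_complex.sel Im_complex_of_real_mult cnj.sel) (simp add: field_simps)
  \<comment> \<open>The second derivative of \<open>\<alpha>\<close> cancels in this
    component.\<close>
  have "(?x * \<omega> s + ?y * cnj (\<alpha> t)) / D.d1 s = - of_real ((norm (C.d1 t))\<^sup>2) * (\<omega> s / D.d1 s)"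
    by (simp only: complex_norm_square) (simp add: algebra_simps)
  then have 2: "Im ((?x * \<omega> s + ?y * cnj (\<alpha> t)) / D.d1 s) / \<rho> t s =
      Im (D.d1 s * cnj (\<omega> s)) * (norm (C.d1 t))\<^sup>2 / ((norm (D.d1 s))\<^sup>2 * \<rho> t s)"
    by (simp only: Im_minus_of_real_mult Im_ratio ts) (rule minus_mult_minus_divide)
  show ?thesis
    unfolding sigma11_def partial11_curve_star[OF ts(1)] normal_part_curve_star[OF ts] 1 2 by simp
qed

lemma sigma12_curve_star:
  assumes ts: "t \<in> I" "s \<in> J"
  shows "sigma12 I J F (t, s) =
    cscale (\<i> * (Im (D.d1 s * cnj (\<omega> s)) / \<rho> t s)) (X t s)
    + cscale (\<i> * (Im (C.d1 t * cnj (\<alpha> t)) / \<rho> t s)) (Y t s)"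
  unfolding sigma12_def partial12_curve_star[OF ts] normal_part_curve_star[OF ts]
  using C.d1_nonzero D.d1_nonzero ts by simp

lemma sigma22_curve_star:
  assumes ts: "t \<in> I" "s \<in> J"
  shows "sigma22 I J F (t, s) =
    cscale (\<i> * (Im (C.d1 t * cnj (\<alpha> t)) * (norm (D.d1 s))\<^sup>2 / ((norm (C.d1 t))\<^sup>2 * \<rho> t s))) (X t s)
    + cscale (\<i> * (Im (D.d2 s / D.d1 s) - Im (D.d1 s * cnj (\<omega> s)) / \<rho> t s)) (Y t s)"
proof -
  let ?x = "D.d2 s * cnj (\<omega> s) + D.d1 s * cnj (D.d1 s)" and ?y = "D.d2 s * \<alpha> t"
  have "(?x * \<omega> s + ?y * cnj (\<alpha> t)) / D.d1 s =
      of_real (\<rho> t s) * (D.d2 s / D.d1 s) + cnj (D.d1 s * cnj (\<omega> s))"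
    using D.d1_nonzero[OF ts(2)]
    by (simp only: of_real_add complex_norm_square) (simp add: field_simps)
  then have 1: "Im ((?x * \<omega> s + ?y * cnj (\<alpha> t)) / D.d1 s) / \<rho> t s =
      Im (D.d2 s / D.d1 s) - Im (D.d1 s * cnj (\<omega> s)) / \<rho> t s"
    using rho_nonzero[OF ts(1), of s] by (simp only: plus_complex.sel Im_complex_of_real_mult cnj.sel) (simp add: field_simps)
  have "(?y * cnj (\<omega> s) - ?x * \<alpha> t) / C.d1 t = - of_real ((norm (D.d1 s))\<^sup>2) * (\<alpha> t / C.d1 t)"
    by (simp only: complex_norm_square) (simp add: algebra_simps)
  then have 2: "Im ((?y * cnj (\<omega> s) - ?x * \<alpha> t) / C.d1 t) / \<rho> t s =
      Im (C.d1 t * cnj (\<alpha> t)) * (norm (D.d1 s))\<^sup>2 / ((norm (C.d1 t))\<^sup>2 * \<rho> t s)"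
    by (simp only: Im_minus_of_real_mult Im_ratio ts) (rule minus_mult_minus_divide)
  show ?thesis
    unfolding sigma22_def partial22_curve_star[OF ts(2)] normal_part_curve_star[OF ts] 1 2 by simp
qed

text \<open>The terms of \<open>sigma11\<close> and \<open>sigma22\<close> depending on both curves cancel in the trace.\<close>

lemma mean_curvature_curve_star:
  assumes ts: "t \<in> I" "s \<in> J"
  shows "mean_curvature I J F (t, s) =
    cscale (\<i> * (Im (C.d2 t / C.d1 t) / (norm (C.d1 t))\<^sup>2 / \<rho> t s)) (X t s)
    + cscale (\<i> * (Im (D.d2 s / D.d1 s) / (norm (D.d1 s))\<^sup>2 / \<rho> t s)) (Y t s)"
proof -
  let ?c = "(norm (C.d1 t))\<^sup>2" and ?d = "(norm (D.d1 s))\<^sup>2" and ?r = "\<rho> t s"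
  define u v where "u = X t s" and "v = Y t s"
  have E: "u \<bullet> u = ?c * ?r" and K: "v \<bullet> v = ?d * ?r"
    unfolding u_def v_def
    by (simp_all add: inner_prod_def norm_mult dot_square_norm algebra_simps power_mult_distrib)
  have G: "u \<bullet> v = 0"
    unfolding inner_hermitian u_def v_def frame_hermitian by simp
  have nz: "?c \<noteq> 0" "?d \<noteq> 0" "?r \<noteq> 0"
    using ts C.d1_nonzero D.d1_nonzero rho_nonzero by auto
  have comb: "k *\<^sub>R (q *\<^sub>R (cscale (\<i> * of_real a) u + cscale (\<i> * of_real b) v) - 0 *\<^sub>R w
      + e *\<^sub>R (cscale (\<i> * of_real a') u + cscale (\<i> * of_real b') v))
      = cscale (\<i> * of_real (k * (q * a + e * a'))) u + cscale (\<i> * of_real (k * (q * b + e * b'))) v"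
    for k q a b e a' b' w
    by (simp add: prod_eq_iff scaleR_conv_of_real algebra_simps)
  have trace: "1 / (c * r * (d * r) - 0\<^sup>2) * (d * r * (x - p / r) + c * r * (p * d / (c * r))) = x / c / r"
      "1 / (c * r * (d * r) - 0\<^sup>2) * (d * r * (q * c / (d * r)) + c * r * (y - q / r)) = y / d / r"
    if "c \<noteq> 0" "d \<noteq> 0" "r \<noteq> 0" for c d r x y p q :: real
    using that by (simp_all add: field_simps)
  show ?thesis
    unfolding mean_curvature_def Let_def partial1_curve_star[OF ts(1)] partial2_curve_star[OF ts(2)]
      sigma11_curve_star[OF ts] sigma22_curve_star[OF ts] u_def[symmetric] v_def[symmetric] E K G
      mult_zero_right comb trace[OF nz]
    by (rule refl)
qed

lemma normal_part_position:
  assumes ts: "t \<in> I" "s \<in> J"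
  shows "normal_part I J F (t, s) (F (t, s)) =
    cscale (\<i> * (Im (\<alpha> t / C.d1 t * ((norm (\<omega> s))\<^sup>2 - D.area s + C.area t)) / \<rho> t s)) (X t s)
    + cscale (\<i> * (Im (\<omega> s / D.d1 s * ((norm (\<alpha> t))\<^sup>2 - C.area t + D.area s)) / \<rho> t s)) (Y t s)"
proof -
  have "(\<alpha> t * \<omega> s * cnj (\<omega> s) - (D.area s - C.area t) * \<alpha> t) / C.d1 t =
      \<alpha> t / C.d1 t * ((norm (\<omega> s))\<^sup>2 - D.area s + C.area t)"
    "((D.area s - C.area t) * \<omega> s + \<alpha> t * \<omega> s * cnj (\<alpha> t)) / D.d1 s =
      \<omega> s / D.d1 s * ((norm (\<alpha> t))\<^sup>2 - C.area t + D.area s)"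
    by (simp_all only: complex_norm_square) (simp_all add: algebra_simps add_divide_distrib diff_divide_distrib)
  then show ?thesis
    by (simp only: curve_star_eq normal_part_curve_star[OF ts])
qed

text \<open>Both sides are imaginary combinations of the independent vectors \<open>X t s\<close>
  and \<open>Y t s\<close>, so coefficients can be compared and the common
  \<open>1 / \<rho> t s\<close> cancels. The real \<open>e\<close> covers shrinkers
  (\<open>e = -1\<close>) and expanders (\<open>e = 1\<close>) together.\<close>

lemma self_similar_equation:
  assumes ts: "t \<in> I" "s \<in> J"
  shows "mean_curvature I J F (t, s) = e *\<^sub>R normal_part I J F (t, s) (F (t, s)) \<longleftrightarrow>
    Im (C.d2 t / C.d1 t) / (norm (C.d1 t))\<^sup>2 =
      e * Im (\<alpha> t / C.d1 t * ((norm (\<omega> s))\<^sup>2 - D.area s + C.area t)) \<and>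
    Im (D.d2 s / D.d1 s) / (norm (D.d1 s))\<^sup>2 =
      e * Im (\<omega> s / D.d1 s * ((norm (\<alpha> t))\<^sup>2 - C.area t + D.area s))"
proof -
  have "cscale (\<i> * of_real (a / r)) (X t s) + cscale (\<i> * of_real (b / r)) (Y t s) =
      e *\<^sub>R (cscale (\<i> * of_real (a' / r)) (X t s) + cscale (\<i> * of_real (b' / r)) (Y t s)) \<longleftrightarrow>
      a = e * a' \<and> b = e * b'" (is "?l \<longleftrightarrow> _") if "r \<noteq> 0" for a b a' b' r
  proof -
    have "?l \<longleftrightarrow> cscale (\<i> * of_real ((a - e * a') / r)) (X t s)
      + cscale (\<i> * of_real ((b - e * b') / r)) (Y t s) = 0"
      by (simp add: prod_eq_iff scaleR_conv_of_real algebra_simps diff_divide_distrib)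
    also have "\<dots> \<longleftrightarrow> \<i> * of_real ((a - e * a') / r) = 0 \<and> \<i> * of_real ((b - e * b') / r) = 0"
      using frame_independent[OF ts ts] by (metis (no_types) add.right_neutral cscale_def mult_zero_left zero_prod_def)
    also have "\<dots> \<longleftrightarrow> a = e * a' \<and> b = e * b'" using that by (simp flip: of_real_mult)
    finally show ?thesis .
  qed
  then show ?thesis
    unfolding mean_curvature_curve_star[OF ts] normal_part_position[OF ts] using rho_nonzero[OF ts(1)] by blast
qed

section \<open>Immersion and Lagrangian property\<close>

lemma immersion_curve_star: "immersion_on I J F"
  unfolding immersion_on_def
proof (intro ballI, elim SigmaE, hypsubst, intro conjI)
  fix t s assume ts: "t \<in> I" "s \<in> J"
  show "inj (\<lambda>(a, b). a *\<^sub>R partial1 I F (t, s) + b *\<^sub>R partial2 J F (t, s))"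
  proof (rule injI, clarify)
    fix a b c d :: real
    assume "a *\<^sub>R partial1 I F (t, s) + b *\<^sub>R partial2 J F (t, s) =
      c *\<^sub>R partial1 I F (t, s) + d *\<^sub>R partial2 J F (t, s)"
    then have "cscale (of_real (a - c)) (X t s) + cscale (of_real (b - d)) (Y t s) = 0"
      unfolding partial1_curve_star[OF ts(1)] partial2_curve_star[OF ts(2)]
      by (simp add: prod_eq_iff scaleR_conv_of_real algebra_simps)
    from frame_independent[OF ts ts this] show "a = c \<and> b = d" by simp
  qed
  have 1: "(\<lambda>p. f (fst p)) differentiable at (t, s) within I \<times> J"
    if f: "f differentiable at t within I" for f :: "real \<Rightarrow> complex"
  proof -
    have "f differentiable at (fst (t, s)) within fst ` (I \<times> J)"
      using differentiable_subset[OF f, of "fst ` (I \<times> J)"] by (simp add: image_subset_iff)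
    then show ?thesis
      using differentiable_chain_within[of fst "(t, s)" "I \<times> J" f]
        bounded_linear_imp_differentiable[OF bounded_linear_fst] ts by (auto simp: o_def)
  qed
  have 2: "(\<lambda>p. f (snd p)) differentiable at (t, s) within I \<times> J"
    if f: "f differentiable at s within J" for f :: "real \<Rightarrow> complex"
  proof -
    have "f differentiable at (snd (t, s)) within snd ` (I \<times> J)"
      using differentiable_subset[OF f, of "snd ` (I \<times> J)"] by (simp add: image_subset_iff)
    then show ?thesis
      using differentiable_chain_within[of snd "(t, s)" "I \<times> J" f]
        bounded_linear_imp_differentiable[OF bounded_linear_snd] ts by (auto simp: o_def)
  qed
  have F: "F = (\<lambda>p. (D.area (snd p) - C.area (fst p), \<alpha> (fst p) * \<omega> (snd p)))"
    by (auto simp: fun_eq_iff curve_star_eq)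
  show "F differentiable at (t, s) within I \<times> J"
    unfolding F
    by (intro differentiable_Pair differentiable_diff differentiable_mult 1 2)
      (rule differentiableI_vector, rule C.has_area D.has_area C.has_d1 D.has_d1, rule ts)+
qed

lemma lagrangian_curve_star: "lagrangian_on I J F"
  unfolding lagrangian_on_def kaehler_form_def
  by (clarify, simp only: partial1_curve_star partial2_curve_star frame_hermitian) simp

end

section \<open>Self-similarity\<close>

context two_curves
begin

text \<open>For fixed \<open>t\<close>, only \<open>|\<omega>|^2 - D.area s\<close> varies with
  \<open>s\<close> in the equation, so its derivative, times \<open>\<alpha> / \<alpha>'\<close>,
  has imaginary part 0. The factor \<open>\<alpha> / \<alpha>'\<close> is a positive multiple of
  \<open>\<alpha> * cnj \<alpha>'\<close>.\<close>

lemma product_real: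
  assumes eq: "\<And>s. s \<in> J \<Longrightarrow> Im (C.d2 t / C.d1 t) / (norm (C.d1 t))\<^sup>2 =
      e * Im (\<alpha> t / C.d1 t * ((norm (\<omega> s))\<^sup>2 - D.area s + C.area t))"
    and "e \<noteq> 0" and t: "t \<in> I" and s: "s \<in> J"
  shows "Im (\<alpha> t * cnj (C.d1 t) * (\<omega> s * cnj (D.d1 s))) = 0"
proof -
  let ?w = "\<alpha> t / C.d1 t"
  have "((\<lambda>s. Im (?w * (\<omega> s * cnj (\<omega> s) - D.area s))) has_vector_derivative
      Im (?w * (\<omega> s * cnj (D.d1 s)))) (at s within J)"
    by (rule has_vector_derivative_Im_mult[OF D.has_norm2_minus_area[OF s]])
  moreover have "Im (?w * (\<omega> s * cnj (\<omega> s) - D.area s)) =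
      Im (C.d2 t / C.d1 t) / (norm (C.d1 t))\<^sup>2 / e - Im (?w * C.area t)" if "s \<in> J" for s
  proof -
    have "Im (?w * ((norm (\<omega> s))\<^sup>2 - D.area s + C.area t)) = Im (C.d2 t / C.d1 t) / (norm (C.d1 t))\<^sup>2 / e"
      using eq[OF that] \<open>e \<noteq> 0\<close> by simp
    then show ?thesis
      by (simp only: complex_norm_square distrib_left plus_complex.sel)
  qed
  ultimately have "Im (?w * (\<omega> s * cnj (D.d1 s))) = 0"
    by (rule D.deriv_const_on[OF s])
  moreover have "\<alpha> t * cnj (C.d1 t) * (\<omega> s * cnj (D.d1 s)) =
      of_real ((norm (C.d1 t))\<^sup>2) * (?w * (\<omega> s * cnj (D.d1 s)))"
    using C.d1_nonzero[OF t] by (simp only: complex_norm_square) simp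
  ultimately show ?thesis by (simp only: Im_complex_of_real_mult)
qed

text \<open>Every frame coefficient of the second fundamental form is built from these two imaginary
  parts and those of \<open>\<alpha>'' / \<alpha>'\<close> and
  \<open>\<omega>'' / \<omega>'\<close>; the latter vanish by \<open>spiral_curvature\<close> with
  \<open>w = 1\<close>.\<close>

lemma totally_geodesic_real:
  assumes p: "\<And>t. t \<in> I \<Longrightarrow> Im (\<alpha> t * cnj (C.d1 t)) = 0"
    and q: "\<And>s. s \<in> J \<Longrightarrow> Im (\<omega> s * cnj (D.d1 s)) = 0"
  shows "totally_geodesic I J F"
  unfolding totally_geodesic_def
proof (intro ballI, elim SigmaE, hypsubst)
  fix t s assume ts: "t \<in> I" "s \<in> J"
  have p': "Im (C.d1 t * cnj (\<alpha> t)) = 0" using p[OF ts(1)] by (simp add: algebra_simps)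
  have q': "Im (D.d1 s * cnj (\<omega> s)) = 0" using q[OF ts(2)] by (simp add: algebra_simps)
  have p2: "Im (C.d2 t / C.d1 t) = 0"
    using C.spiral_curvature[of 1 t] p ts by (simp del: times_complex.sel)
  have q2: "Im (D.d2 s / D.d1 s) = 0"
    using D.spiral_curvature[of 1 s] q ts by (simp del: times_complex.sel)
  show "sigma11 I J F (t, s) = 0 \<and> sigma12 I J F (t, s) = 0 \<and> sigma22 I J F (t, s) = 0"
    unfolding sigma11_curve_star[OF ts] sigma12_curve_star[OF ts] sigma22_curve_star[OF ts] p' q' p2 q2
    by (simp add: cscale_def zero_prod_def)
qed

lemma self_similar_imp_circles:
  assumes eq: "\<And>t s. t \<in> I \<Longrightarrow> s \<in> J \<Longrightarrow>
      mean_curvature I J F (t, s) = e *\<^sub>R normal_part I J F (t, s) (F (t, s))"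
    and e: "\<bar>e\<bar> = 1" and ntg: "\<not> totally_geodesic I J F"
  shows "\<exists>r>0. (\<forall>t\<in>I. norm (\<alpha> t) = r) \<and> (\<forall>s\<in>J. norm (\<omega> s) = 1 / r)"
proof -
  let ?p = "\<lambda>t. \<alpha> t * cnj (C.d1 t)" and ?q = "\<lambda>s. \<omega> s * cnj (D.d1 s)"
  have eqs: "Im (C.d2 t / C.d1 t) / (norm (C.d1 t))\<^sup>2 =
      e * Im (\<alpha> t / C.d1 t * ((norm (\<omega> s))\<^sup>2 - D.area s + C.area t))"
    "Im (D.d2 s / D.d1 s) / (norm (D.d1 s))\<^sup>2 =
      e * Im (\<omega> s / D.d1 s * ((norm (\<alpha> t))\<^sup>2 - C.area t + D.area s))"
    if "t \<in> I" "s \<in> J" for t s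
    using eq[OF that] unfolding self_similar_equation[OF that] by blast+
  have "e \<noteq> 0" using e by auto
  have pq: "Im (?p t * ?q s) = 0" if "t \<in> I" "s \<in> J" for t s
    using product_real[OF eqs(1) \<open>e \<noteq> 0\<close> that] that by blast
  have real: "Im v = 0" if "Im (u * v) = 0" "Im u = 0" "u \<noteq> 0" for u v
    using that by (auto simp: complex_eq_iff)
  have p0: "?p t \<noteq> 0" if "t \<in> I" for t
    using C.nonzero C.d1_nonzero that by simp
  have q0: "?q s \<noteq> 0" if "s \<in> J" for s
    using D.nonzero D.d1_nonzero that by simp
  have q_real: "Im (?q s) = 0" if "t \<in> I" "s \<in> J" "Im (?p t) = 0" for t s
    using real[OF pq[OF that(1,2)] that(3) p0[OF that(1)]] .
  have p_real: "Im (?p t) = 0" if "t \<in> I" "s \<in> J" "Im (?q s) = 0" for t s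
    using real[of "?q s" "?p t"] pq[OF that(1,2)] that(3) q0[OF that(2)] by (simp only: mult.commute) blast
  \<comment> \<open>One real value of \<open>?p\<close> makes \<open>?q\<close> real everywhere, and
    then \<open>?p\<close> real everywhere, which is the totally geodesic case; likewise for
    \<open>?q\<close>.\<close>
  have nonreal: "Im (?p t) \<noteq> 0" "Im (?q s) \<noteq> 0" if "t \<in> I" "s \<in> J" for t s
    using totally_geodesic_real p_real q_real that ntg by metis+
  \<comment> \<open>\<open>D.area\<close> vanishes at \<open>s0\<close>, so the first equation there
    has the form of \<open>spiral_equation\<close> with \<open>w = ?q s0\<close>.\<close>
  have C: "1 / (norm (\<alpha> t))\<^sup>2 + e * (norm (\<omega> s0))\<^sup>2 = 0" if t: "t \<in> I" for t
  proof -
    have "Im (?p t) * (1 / (norm (\<alpha> t))\<^sup>2 + e * (norm (\<omega> s0))\<^sup>2) = 0"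
    proof (rule C.spiral_equation[THEN iffD1, OF _ q0[OF D.t0] t])
      show "Im (?p t * ?q s0) = 0" if "t \<in> I" for t using pq[OF that D.t0] .
    qed (use eqs(1)[OF t D.t0] in simp)
    then show ?thesis using nonreal(1)[OF t D.t0] by (simp only: mult_eq_0_iff) blast
  qed
  have D: "1 / (norm (\<omega> s))\<^sup>2 + e * (norm (\<alpha> t0))\<^sup>2 = 0" if s: "s \<in> J" for s
  proof -
    have "Im (?q s) * (1 / (norm (\<omega> s))\<^sup>2 + e * (norm (\<alpha> t0))\<^sup>2) = 0"
    proof (rule D.spiral_equation[THEN iffD1, OF _ p0[OF C.t0] s])
      show "Im (?q s * ?p t0) = 0" if "s \<in> J" for s
        using pq[OF C.t0 that] by (simp only: mult.commute)
    qed (use eqs(2)[OF C.t0 s] in simp)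
    then show ?thesis using nonreal(2)[OF C.t0 s] by (simp only: mult_eq_0_iff) blast
  qed
  have pos: "norm (\<alpha> t) > 0" "norm (\<omega> s) > 0" if "t \<in> I" "s \<in> J" for t s
    using C.nonzero D.nonzero that by auto
  \<comment> \<open>The sign is decided here: for \<open>e = 1\<close> the sum is positive, so no
    expander survives.\<close>
  have inv: "norm x = 1 / norm y"
    if "1 / (norm x)\<^sup>2 + e * (norm y)\<^sup>2 = 0" "norm x > 0" "norm y > 0" for x y :: complex
  proof -
    have "e = -1"
    proof (rule ccontr)
      assume "e \<noteq> -1"
      then have "e = 1" using e by linarith
      then have "1 / (norm x)\<^sup>2 + e * (norm y)\<^sup>2 > 0"
        using that(2,3) by (simp add: add_pos_pos)
      then show False using that(1) by simp
    qed
    then have "(norm x * norm y)\<^sup>2 = 1" using that by (simp add: field_simps)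
    then have "norm x * norm y = 1"
      using that(2,3) by (metis mult_nonneg_nonneg norm_ge_zero power2_eq_imp_eq one_power2 zero_le_one)
    then show ?thesis using that(3) by (simp add: field_simps)
  qed
  have "norm (\<alpha> t) = norm (\<alpha> t0)" if "t \<in> I" for t
    using inv[OF C[OF that] pos[OF that D.t0]] inv[OF C[OF C.t0] pos[OF C.t0 D.t0]] by simp
  moreover have "norm (\<omega> s) = 1 / norm (\<alpha> t0)" if "s \<in> J" for s
    using inv[OF D[OF that]] pos[OF C.t0 that] by blast
  ultimately show ?thesis using pos(1)[OF C.t0 D.t0] by blast
qed

text \<open>Reciprocal radii make the last factor in \<open>spiral_equation\<close> vanish. The
  remaining term contributes nothing, because \<open>\<alpha> / \<alpha>'\<close> and
  \<open>D.area s\<close> are both imaginary and have a real product.\<close>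

lemma circles_equation:
  assumes r: "\<And>t. t \<in> I \<Longrightarrow> norm (\<alpha> t) = r" "\<And>s. s \<in> J \<Longrightarrow> norm (\<omega> s) = 1 / r" and "r > 0"
    and ts: "t \<in> I" "s \<in> J"
  shows "Im (C.d2 t / C.d1 t) / (norm (C.d1 t))\<^sup>2 =
      (-1) * Im (\<alpha> t / C.d1 t * ((norm (\<omega> s))\<^sup>2 - D.area s + C.area t))"
proof -
  have p: "Re (\<alpha> t * cnj (C.d1 t)) = 0" if "t \<in> I" for t
    using C.circle_spiral[OF r(1) that] .
  have "Im (C.d2 t / C.d1 t) / (norm (C.d1 t))\<^sup>2 =
      (-1) * Im (\<alpha> t / C.d1 t * (of_real ((norm (\<omega> s))\<^sup>2) + C.area t))"
  proof (rule C.spiral_equation[THEN iffD2])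
    show "Im (\<alpha> t * cnj (C.d1 t) * \<i>) = 0" if "t \<in> I" for t
      using p[OF that] by simp
    show "Im (\<alpha> t * cnj (C.d1 t)) * (1 / (norm (\<alpha> t))\<^sup>2 + - 1 * (norm (\<omega> s))\<^sup>2) = 0"
      using r ts by (simp add: power_divide)
  qed (use ts in auto)
  moreover have "Im (\<alpha> t / C.d1 t * D.area s) = 0"
  proof -
    have "\<alpha> t / C.d1 t = (\<alpha> t * cnj (C.d1 t)) / of_real ((norm (C.d1 t))\<^sup>2)"
      using C.d1_nonzero[OF ts(1)] by (simp only: complex_norm_square) simp
    then have "Re (\<alpha> t / C.d1 t) = 0"
      using p[OF ts(1)] by (simp only: Re_divide_of_real)
    moreover have "Re (D.area s) = 0" using D.circle_area[OF r(2) ts(2)] .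
    ultimately show ?thesis by (simp only: times_complex.sel)
  qed
  moreover have "\<alpha> t / C.d1 t * ((norm (\<omega> s))\<^sup>2 - D.area s + C.area t) =
      \<alpha> t / C.d1 t * (of_real ((norm (\<omega> s))\<^sup>2) + C.area t) - \<alpha> t / C.d1 t * D.area s"
    by (simp add: algebra_simps)
  ultimately show ?thesis by (simp only: minus_complex.sel diff_zero)
qed

text \<open>Exchanging the curves flips the sign of the first coordinate of the surface, but turns
  the first scalar equation into the second, and only this is used.\<close>

interpretation swap: two_curves J s0 \<omega> I t0 \<alpha> ..

lemma circles_imp_self_shrinker:
  assumes r: "\<And>t. t \<in> I \<Longrightarrow> norm (\<alpha> t) = r" "\<And>s. s \<in> J \<Longrightarrow> norm (\<omega> s) = 1 / r" and "r > 0"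
  shows "self_shrinker I J F"
  unfolding self_shrinker_def
proof (intro conjI immersion_curve_star ballI, elim SigmaE, hypsubst)
  fix t s assume ts: "t \<in> I" "s \<in> J"
  have "mean_curvature I J F (t, s) = (- 1) *\<^sub>R normal_part I J F (t, s) (F (t, s))"
    unfolding self_similar_equation[OF ts]
    using circles_equation[OF r \<open>r > 0\<close> ts] swap.circles_equation[of "1 / r", OF r(2) _ _ ts(2,1)] r(1) \<open>r > 0\<close>
    by simp
  then show "mean_curvature I J F (t, s) = - normal_part I J F (t, s) (F (t, s))" by simp
qed

text \<open>The \<open>Y\<close> coefficient of \<open>sigma11\<close> is a nonzero multiple of
  \<open>Im (\<omega>' * cnj \<omega>)\<close>, and on a circle
  \<open>\<omega>' * cnj \<omega>\<close> is imaginary and nonzero.\<close>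

lemma circles_imp_not_totally_geodesic:
  assumes r: "\<And>s. s \<in> J \<Longrightarrow> norm (\<omega> s) = r"
  shows "\<not> totally_geodesic I J F"
proof
  assume "totally_geodesic I J F"
  then have "sigma11 I J F (t0, s0) = 0"
    unfolding totally_geodesic_def using C.t0 D.t0 by blast
  then have "\<i> * (Im (D.d1 s0 * cnj (\<omega> s0)) * (norm (C.d1 t0))\<^sup>2 / ((norm (D.d1 s0))\<^sup>2 * \<rho> t0 s0)) = 0"
    unfolding sigma11_curve_star[OF C.t0 D.t0] by (rule frame_independent(2)[OF C.t0 D.t0 C.t0 D.t0])
  then have "Im (D.d1 s0 * cnj (\<omega> s0)) = 0"
    using C.d1_nonzero[OF C.t0] D.d1_nonzero[OF D.t0] rho_nonzero[OF C.t0, of s0]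
    using C.nonzero[OF C.t0] by (simp del: of_real_add times_complex.sel of_real_mult)
  moreover have "Re (D.d1 s0 * cnj (\<omega> s0)) = 0"
    using D.circle_spiral[OF r D.t0] by (simp add: algebra_simps)
  ultimately have "D.d1 s0 * cnj (\<omega> s0) = 0" by (simp only: complex_eq_iff zero_complex.sel)
  then show False using D.nonzero[OF D.t0] D.d1_nonzero[OF D.t0] by simp
qed

lemma self_similar_iff_circles:
  "self_similar_solution I J F \<and> \<not> totally_geodesic I J F \<longleftrightarrow>
    (\<exists>r>0. on_centred_circle I \<alpha> r \<and> on_centred_circle J \<omega> (1 / r))"
proof -
  have circ: "on_centred_circle K \<gamma> r \<longleftrightarrow> (\<forall>t\<in>K. norm (\<gamma> t) = r)" for K \<gamma> r
    by (auto simp: on_centred_circle_def)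
  show ?thesis unfolding circ
  proof
    assume A: "self_similar_solution I J F \<and> \<not> totally_geodesic I J F"
    then obtain e :: real where "\<bar>e\<bar> = 1" and
      "\<And>p. p \<in> I \<times> J \<Longrightarrow> mean_curvature I J F p = e *\<^sub>R normal_part I J F p (F p)"
      unfolding self_similar_solution_def self_shrinker_def self_expander_def
      by (metis (no_types) abs_minus_cancel abs_one scaleR_minus1_left scaleR_one)
    then show "\<exists>r>0. (\<forall>t\<in>I. norm (\<alpha> t) = r) \<and> (\<forall>s\<in>J. norm (\<omega> s) = 1 / r)"
      using A by (intro self_similar_imp_circles) auto
  next
    assume "\<exists>r>0. (\<forall>t\<in>I. norm (\<alpha> t) = r) \<and> (\<forall>s\<in>J. norm (\<omega> s) = 1 / r)"
    then show "self_similar_solution I J F \<and> \<not> totally_geodesic I J F"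
      using circles_imp_self_shrinker circles_imp_not_totally_geodesic
      unfolding self_similar_solution_def by metis
  qed
qed

end

section \<open>The cylinder\<close>

text \<open>The exponential is a covering of the punctured plane, hence an open map; open boxes
  reduce the claim to it.\<close>

lemma open_exp_snd_image:
  fixes S :: "(complex \<times> complex) set"
  assumes "open S"
  shows "open ((\<lambda>(a, b). (a, exp b)) ` S)"
proof (subst open_subopen, intro ballI)
  fix z assume "z \<in> (\<lambda>(a, b). (a, exp b)) ` S"
  then obtain a b where ab: "(a, b) \<in> S" and z: "z = (a, exp b)" by auto
  obtain A B where AB: "open A" "open B" "(a, b) \<in> A \<times> B" "A \<times> B \<subseteq> S"
    using open_prod_elim[OF assms ab] .
  have "openin (top_of_set (- {0})) (exp ` B)"
    using covering_space_open_map[OF covering_space_exp_punctured_plane] \<open>open B\<close> by simp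
  then have "open (exp ` B)"
    using openin_open_trans open_Compl closed_singleton by metis
  then have "open (A \<times> exp ` B)" using \<open>open A\<close> by (rule open_Times[rotated])
  moreover have "A \<times> exp ` B \<subseteq> (\<lambda>(a, b). (a, exp b)) ` S"
    using AB(4) by (force simp: image_iff)
  ultimately show "\<exists>T. open T \<and> z \<in> T \<and> T \<subseteq> (\<lambda>(a, b). (a, exp b)) ` S"
    using AB(3) z by blast
qed

text \<open>The universal covering of the cylinder by the plane; \<open>c\<close> will be an
  argument of \<open>\<alpha> t0 * \<omega> s0\<close>.\<close>

definition cylinder_map :: "real \<Rightarrow> real \<times> real \<Rightarrow> complex \<times> complex" where
  "cylinder_map c = (\<lambda>(x, y). (\<i> * of_real x, exp (\<i> * of_real (c + y))))"

lemma range_cylinder_map: "range (cylinder_map c) = right_circular_cylinder"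
proof (intro equalityI subsetI)
  fix z assume "z \<in> right_circular_cylinder"
  then have z: "Re (fst z) = 0" "norm (snd z) = 1"
    by (auto simp: right_circular_cylinder_def)
  then obtain y where "snd z = exp (\<i> * of_real y)"
    using complex_norm_eq_1_exp by metis
  then have "z = cylinder_map c (Im (fst z), y - c)"
    using z(1) by (simp add: cylinder_map_def prod_eq_iff complex_eq_iff)
  then show "z \<in> range (cylinder_map c)" by blast
qed (auto simp: right_circular_cylinder_def cylinder_map_def)

text \<open>\<open>V\<close> is thickened to an open set \<open>S\<close> by leaving the real parts
  free; its image under the exponential is open and is then cut with the cylinder.\<close>

lemma open_map_cylinder_map:
  assumes "open V"
  shows "openin (top_of_set right_circular_cylinder) (cylinder_map c ` V)"
proof -
  define S :: "(complex \<times> complex) set" where "S = {z. (Im (fst z), Im (snd z) - c) \<in> V}"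
  let ?W = "(\<lambda>(a, b). (a, exp b)) ` S"
  have "open S"
  proof -
    have "S = (\<lambda>z. (Im (fst z), Im (snd z) - c)) -` V" by (auto simp: S_def)
    then show ?thesis
      using assms by (auto intro!: open_vimage continuous_intros)
  qed
  then have "open ?W" by (rule open_exp_snd_image)
  moreover have "cylinder_map c ` V = right_circular_cylinder \<inter> ?W"
  proof (intro equalityI subsetI IntI)
    fix z assume z: "z \<in> cylinder_map c ` V"
    then show "z \<in> right_circular_cylinder" using range_cylinder_map by blast
    from z obtain x y where xy: "(x, y) \<in> V" "z = cylinder_map c (x, y)" by auto
    then have "(\<i> * of_real x, \<i> * of_real (c + y)) \<in> S" by (simp add: S_def)
    then show "z \<in> ?W"
      unfolding xy(2) cylinder_map_def by (rule rev_image_eqI) simp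
  next
    fix z assume "z \<in> right_circular_cylinder \<inter> ?W"
    then obtain a b where ab: "(a, b) \<in> S" and z: "z = (a, exp b)" "Re a = 0" "norm (exp b) = 1"
      by (auto simp: right_circular_cylinder_def)
    \<comment> \<open>On the cylinder the freed real parts are forced back to 0, so the point comes
      from \<open>V\<close>.\<close>
    have "Re b = 0" using z(3) by simp
    then have "z = cylinder_map c (Im a, Im b - c)"
      using z(1,2) by (simp add: cylinder_map_def complex_eq_iff exp_eq_polar cis.simps Re_exp Im_exp)
    then show "z \<in> cylinder_map c ` V" using ab by (auto simp: S_def)
  qed
  ultimately show ?thesis unfolding openin_open by blast
qed

context two_curves
begin

text \<open>By \<open>circle_lift\<close> the angles are the imaginary areas divided by the squared
  radii, and they add in the product. Radius \<open>1 / r\<close> accounts for the factor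
  \<open>r^2\<close>.\<close>

lemma circles_curve_star:
  assumes r: "\<And>t. t \<in> I \<Longrightarrow> norm (\<alpha> t) = r" "\<And>s. s \<in> J \<Longrightarrow> norm (\<omega> s) = 1 / r" and "r > 0"
  obtains c where "\<And>t s. t \<in> I \<Longrightarrow> s \<in> J \<Longrightarrow> F (t, s) =
    cylinder_map c (Im (D.area s) - Im (C.area t), r\<^sup>2 * Im (D.area s) + Im (C.area t) / r\<^sup>2)"
proof -
  have "norm (\<alpha> t0 * \<omega> s0) = 1"
    using r(1)[OF C.t0] r(2)[OF D.t0] \<open>r > 0\<close> by (simp add: norm_mult)
  then obtain c where c: "\<alpha> t0 * \<omega> s0 = exp (\<i> * of_real c)"
    using complex_norm_eq_1_exp by metis
  show thesis
  proof (rule that[of c])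
    fix t s assume ts: "t \<in> I" "s \<in> J"
    have a: "C.area t = \<i> * of_real (Im (C.area t))"
      using C.circle_area[OF r(1) ts(1)] by (simp add: complex_eq_iff)
    have o: "D.area s = \<i> * of_real (Im (D.area s))"
      using D.circle_area[OF r(2) ts(2)] by (simp add: complex_eq_iff)
    have "\<alpha> t * \<omega> s = (\<alpha> t0 * \<omega> s0) * exp (C.area t / of_real (r\<^sup>2) + D.area s / of_real ((1 / r)\<^sup>2))"
      unfolding exp_add using C.circle_lift[OF r(1) ts(1)] D.circle_lift[OF r(2) ts(2)] by (metis mult.assoc mult.left_commute)
    also have "C.area t / of_real (r\<^sup>2) + D.area s / of_real ((1 / r)\<^sup>2) =
        \<i> * of_real (r\<^sup>2 * Im (D.area s) + Im (C.area t) / r\<^sup>2)"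
      by (subst a, subst o) (simp add: algebra_simps power_divide)
    finally have "\<alpha> t * \<omega> s = exp (\<i> * of_real (c + (r\<^sup>2 * Im (D.area s) + Im (C.area t) / r\<^sup>2)))"
      unfolding c by (simp add: exp_add[symmetric] algebra_simps)
    moreover have "D.area s - C.area t = \<i> * of_real (Im (D.area s) - Im (C.area t))"
      by (subst a, subst o) (simp add: algebra_simps)
    ultimately show "F (t, s) =
      cylinder_map c (Im (D.area s) - Im (C.area t), r\<^sup>2 * Im (D.area s) + Im (C.area t) / r\<^sup>2)"
      by (simp only: curve_star_eq cylinder_map_def split_conv)
  qed
qed

text \<open>The surface is the pair of areas, followed by the linear map \<open>L\<close>, followed
  by the covering \<open>cylinder_map c\<close>. Openness and surjectivity are checked factor by
  factor.\<close>

lemma circles_cylinder: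
  assumes circ: "on_centred_circle I \<alpha> r" "on_centred_circle J \<omega> (1 / r)" and "r > 0"
  shows "F ` (I \<times> J) \<subseteq> right_circular_cylinder"
    and "openin (top_of_set right_circular_cylinder) (F ` (interior I \<times> interior J))"
    and "I = UNIV \<Longrightarrow> J = UNIV \<Longrightarrow> \<exists>c. \<forall>t. norm (C.d1 t) = c \<Longrightarrow> \<exists>d. \<forall>s. norm (D.d1 s) = d \<Longrightarrow>
      F ` (I \<times> J) = right_circular_cylinder"
proof -
  have r: "norm (\<alpha> t) = r" if "t \<in> I" for t
    using circ(1) that by (auto simp: on_centred_circle_def)
  have r': "norm (\<omega> s) = 1 / r" if "s \<in> J" for s
    using circ(2) that by (auto simp: on_centred_circle_def)
  \<comment> \<open>\<open>L\<close> has determinant \<open>- (r^2 + 1 / r^2)\<close>, and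
    \<open>M\<close> is its inverse by Cramer's rule.\<close>
  define L where "L = (\<lambda>(a, b). (b - a :: real, r\<^sup>2 * b + a / r\<^sup>2))"
  define M where "M = (\<lambda>(x, y). ((y - r\<^sup>2 * x) / (r\<^sup>2 + 1 / r\<^sup>2), (y + x / r\<^sup>2) / (r\<^sup>2 + 1 / r\<^sup>2)))"
  have nz: "r\<^sup>2 + 1 / r\<^sup>2 \<noteq> 0"
    using \<open>r > 0\<close> by (smt (verit) divide_pos_pos zero_less_power)
  have inv1: "M (L z) = z" and inv2: "L (M z) = z" for z
  proof -
    have *: "(r\<^sup>2 * b + a / r\<^sup>2) - r\<^sup>2 * (b - a) = a * (r\<^sup>2 + 1 / r\<^sup>2)"
      "(r\<^sup>2 * b + a / r\<^sup>2) + (b - a) / r\<^sup>2 = b * (r\<^sup>2 + 1 / r\<^sup>2)" for a b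
      by (simp_all add: algebra_simps diff_divide_distrib)
    show "M (L z) = z"
      using nz by (cases z) (simp only: L_def M_def split_conv *, simp)
    have **: "(y + x / r\<^sup>2) / k - (y - r\<^sup>2 * x) / k = x * (r\<^sup>2 + 1 / r\<^sup>2) / k"
      "r\<^sup>2 * ((y + x / r\<^sup>2) / k) + ((y - r\<^sup>2 * x) / k) / r\<^sup>2 = y * (r\<^sup>2 + 1 / r\<^sup>2) / k" for x y k
      using \<open>r > 0\<close> by (simp_all add: diff_divide_distrib add_divide_distrib algebra_simps)
    show "L (M z) = z"
      using nz by (cases z) (simp only: L_def M_def split_conv **, simp)
  qed
  obtain c where F: "F (t, s) = cylinder_map c (L (Im (C.area t), Im (D.area s)))"
    if "t \<in> I" "s \<in> J" for t s
    unfolding L_def split_conv using circles_curve_star[OF r r' \<open>r > 0\<close>] by metis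
  have img: "F ` (A \<times> B) = cylinder_map c ` L ` ((\<lambda>t. Im (C.area t)) ` A \<times> (\<lambda>s. Im (D.area s)) ` B)"
    if "A \<subseteq> I" "B \<subseteq> J" for A B
  proof -
    have "F ` (A \<times> B) = (\<lambda>(t, s). cylinder_map c (L (Im (C.area t), Im (D.area s)))) ` (A \<times> B)"
      using that by (intro image_cong) (auto simp: F subset_iff)
    then show ?thesis by (auto simp: image_iff) metis+
  qed
  show "F ` (I \<times> J) \<subseteq> right_circular_cylinder"
    unfolding img[OF order_refl order_refl] using range_cylinder_map by blast
  show "openin (top_of_set right_circular_cylinder) (F ` (interior I \<times> interior J))"
    unfolding img[OF interior_subset interior_subset]
  proof (rule open_map_cylinder_map)
    \<comment> \<open>Images under \<open>L\<close> are preimages under \<open>M\<close>, so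
      openness follows from continuity of \<open>M\<close>.\<close>
    have *: "L ` S = M -` S" for S
      using inv1 inv2 by (auto simp: image_iff) metis
    have "continuous_on UNIV M"
      unfolding M_def case_prod_unfold using nz by (intro continuous_intros) auto
    then show "open (L ` ((\<lambda>t. Im (C.area t)) ` interior I \<times> (\<lambda>s. Im (D.area s)) ` interior J))"
      unfolding * by (intro open_vimage open_Times C.circle_area_open[OF r] D.circle_area_open[OF r'])
  qed
  show "F ` (I \<times> J) = right_circular_cylinder"
    if "I = UNIV" "J = UNIV" "\<exists>c. \<forall>t. norm (C.d1 t) = c" "\<exists>d. \<forall>s. norm (D.d1 s) = d"
  proof -
    have "(\<lambda>t. Im (C.area t)) ` I = UNIV"
      using C.circle_area_surj[OF r] that by blast
    moreover have "(\<lambda>s. Im (D.area s)) ` J = UNIV"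
      using D.circle_area_surj[OF r'] that by blast
    moreover have "surj L" using inv2 by (rule surjI)
    ultimately show ?thesis
      unfolding img[OF order_refl order_refl] by (simp add: range_cylinder_map)
  qed
qed

end

text \<open>Radii \<open>r\<close> and \<open>1 / r\<close> give the same cylinder, so equal moduli
  at the base points serve to normalise both radii to one. Short arcs cover only a piece of the
  cylinder, hence the openness clause; constant speed on the whole line makes both swept angles
  unbounded in either direction and yields the entire cylinder.\<close>

theorem corollary3p5:
  fixes I1 I2 :: "real set" and t0 s0 :: real and \<alpha> \<omega> :: "real \<Rightarrow> complex"
    and \<Phi> :: "real \<times> real \<Rightarrow> complex \<times> complex"
  assumes "nondegenerate_interval I1" and "nondegenerate_interval I2"
    and "t0 \<in> I1" and "s0 \<in> I2"
    and "regular_curve I1 \<alpha>" and "\<forall>t\<in>I1. \<alpha> t \<noteq> 0"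
    and "regular_curve I2 \<omega>" and "\<forall>s\<in>I2. \<omega> s \<noteq> 0"
    and "\<Phi> = curve_star I1 I2 t0 s0 \<alpha> \<omega>"
  shows "immersion_on I1 I2 \<Phi> \<and> lagrangian_on I1 I2 \<Phi> \<and>
         ((self_similar_solution I1 I2 \<Phi> \<and> \<not> totally_geodesic I1 I2 \<Phi>) \<longleftrightarrow>
            (\<exists>r>0. on_centred_circle I1 \<alpha> r \<and> on_centred_circle I2 \<omega> (1 / r))) \<and>
         (norm (\<alpha> t0) = norm (\<omega> s0) \<longrightarrow>
            ((self_similar_solution I1 I2 \<Phi> \<and> \<not> totally_geodesic I1 I2 \<Phi>) \<longleftrightarrow>
             (on_centred_circle I1 \<alpha> 1 \<and> on_centred_circle I2 \<omega> 1))) \<and>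
         (\<forall>r>0. on_centred_circle I1 \<alpha> r \<and> on_centred_circle I2 \<omega> (1 / r) \<longrightarrow>
            \<Phi> ` (I1 \<times> I2) \<subseteq> right_circular_cylinder \<and>
            openin (top_of_set right_circular_cylinder) (\<Phi> ` (interior I1 \<times> interior I2)) \<and>
            (I1 = UNIV \<and> I2 = UNIV \<and>
             (\<exists>c. \<forall>t. norm (curve_deriv I1 \<alpha> t) = c) \<and> (\<exists>d. \<forall>s. norm (curve_deriv I2 \<omega> s) = d) \<longrightarrow>
               \<Phi> ` (I1 \<times> I2) = right_circular_cylinder))"
proof -
  interpret two_curves I1 t0 \<alpha> I2 s0 \<omega>
    by unfold_locales (use assms in auto)
  have "r = 1" if "norm (\<alpha> t0) = norm (\<omega> s0)" "r > 0"
    "on_centred_circle I1 \<alpha> r" "on_centred_circle I2 \<omega> (1 / r)" for r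
  proof -
    have "norm (\<alpha> t0) = r" "norm (\<omega> s0) = 1 / r"
      using that(3,4) assms(3,4) by (auto simp: on_centred_circle_def)
    then have "r * r = 1" using that(1,2) by (simp add: field_simps)
    then show ?thesis using that(2) by (smt (verit) mult_less_cancel_left2 mult_le_cancel_left1)
  qed
  then have unit: "(\<exists>r>0. on_centred_circle I1 \<alpha> r \<and> on_centred_circle I2 \<omega> (1 / r)) \<longleftrightarrow>
      on_centred_circle I1 \<alpha> 1 \<and> on_centred_circle I2 \<omega> 1" if "norm (\<alpha> t0) = norm (\<omega> s0)"
    using that by (metis div_by_1 zero_less_one)
  show ?thesis
    unfolding \<open>\<Phi> = _\<close> self_similar_iff_circles
  proof (intro conjI impI allI immersion_curve_star lagrangian_curve_star refl unit)
    fix r :: real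
    assume "0 < r" and "on_centred_circle I1 \<alpha> r \<and> on_centred_circle I2 \<omega> (1 / r)"
    then have circ: "on_centred_circle I1 \<alpha> r" "on_centred_circle I2 \<omega> (1 / r)" "0 < r" by auto
    show "F ` (I1 \<times> I2) \<subseteq> right_circular_cylinder"
      and "openin (top_of_set right_circular_cylinder) (F ` (interior I1 \<times> interior I2))"
      using circles_cylinder(1,2)[OF circ] .
    assume "I1 = UNIV \<and> I2 = UNIV \<and> (\<exists>c. \<forall>t. norm (C.d1 t) = c) \<and> (\<exists>d. \<forall>s. norm (D.d1 s) = d)"
    then show "F ` (I1 \<times> I2) = right_circular_cylinder"
      by (elim conjE) (rule circles_cylinder(3)[OF circ])
  qed
qed

end
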